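(* Let $G$ be a finite simple graph with $n$ vertices and $m$ edges. Then \[NK(G^{-++}) = (n-1)^{n}\,\Pi_1^{*}(G).\]
   Context: For a graph $H$, $NK(H)=\prod_{v\in V(H)} d_H(v)$ (Narumi-Katayama index). The multiplicative sum Zagreb index is $\Pi_1^*(G)=\prod_{uv\in E(G)}[d_G(u)+d_G(v)]$. For $x,y,z\in\{+,-\}$ the total transformation graph $G^{xyz}$ has vertex set $V(G)\cup E(G)$ (disjoint union) and two distinct vertices are adjacent as follows: two vertices of $G$ are adjacent iff they are adjacent in $G$ (if $x=+$), resp. non-adjacent in $G$ (if $x=-$); two edges of $G$ are adjacent iff they share an endpoint in $G$ (if $y=+$), resp. share no endpoint (if $y=-$); a vertex $u$ and an edge $e$ of $G$ are adjacent iff $u$ is incident to $e$ (if $z=+$), resp. not incident (if $z=-$). *)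

theory Defs
  imports Main
begin

type_synonym 'a graph = "'a set \<times> 'a set set"

abbreviation verts :: "'a graph \<Rightarrow> 'a set" where
  "verts G \<equiv> fst G"

abbreviation edges :: "'a graph \<Rightarrow> 'a set set" where
  "edges G \<equiv> snd G"

definition finite_simple_graph :: "'a graph \<Rightarrow> bool" where
  "finite_simple_graph G \<longleftrightarrow>
     finite (verts G) \<and> (\<forall>e \<in> edges G. e \<subseteq> verts G \<and> card e = 2)"

definition adjacent :: "'a graph \<Rightarrow> 'a \<Rightarrow> 'a \<Rightarrow> bool" where
  "adjacent G u v \<longleftrightarrow> {u, v} \<in> edges G"

definition vertex_degree :: "'a graph \<Rightarrow> 'a \<Rightarrow> nat" where
  "vertex_degree G v = card {e \<in> edges G. v \<in> e}"

definition NK :: "'a graph \<Rightarrow> nat" where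
  "NK G = (\<Prod>v \<in> verts G. vertex_degree G v)"

text \<open>An edge is the two-element set of its endpoints, so for an edge \<open>e\<close> with endpoints
  \<open>u\<close> and \<open>v\<close> the inner sum is the sum of the degrees of \<open>u\<close> and \<open>v\<close>.\<close>

definition mult_sum_Zagreb :: "'a graph \<Rightarrow> nat" where
  "mult_sum_Zagreb G = (\<Prod>e \<in> edges G. \<Sum>v \<in> e. vertex_degree G v)"

datatype sign = Plus | Minus

fun signed :: "sign \<Rightarrow> bool \<Rightarrow> bool" where
  "signed Plus P \<longleftrightarrow> P"
| "signed Minus P \<longleftrightarrow> \<not> P"

text \<open>The relation below is only meant for distinct arguments; the definition of
  \<open>total_transformation\<close> imposes distinctness.\<close>

fun transformation_adj ::
  "sign \<Rightarrow> sign \<Rightarrow> sign \<Rightarrow> 'a graph \<Rightarrow> 'a + 'a set \<Rightarrow> 'a + 'a set \<Rightarrow> bool" where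
  "transformation_adj x y z G (Inl u) (Inl v) \<longleftrightarrow> signed x (adjacent G u v)"
| "transformation_adj x y z G (Inr e) (Inr f) \<longleftrightarrow> signed y (e \<inter> f \<noteq> {})"
| "transformation_adj x y z G (Inl u) (Inr e) \<longleftrightarrow> signed z (u \<in> e)"
| "transformation_adj x y z G (Inr e) (Inl u) \<longleftrightarrow> signed z (u \<in> e)"

definition total_transformation ::
  "sign \<Rightarrow> sign \<Rightarrow> sign \<Rightarrow> 'a graph \<Rightarrow> ('a + 'a set) graph" where
  "total_transformation x y z G =
     (let W = verts G <+> edges G
      in (W, {{a, b} | a b. a \<in> W \<and> b \<in> W \<and> a \<noteq> b \<and> transformation_adj x y z G a b}))"

lemma transformation_adj_sym:
  "transformation_adj x y z G a b \<longleftrightarrow> transformation_adj x y z G b a"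
  by (cases a; cases b) (simp_all add: adjacent_def insert_commute Int_commute)

lemma adjacent_total_transformation:
  "adjacent (total_transformation x y z G) a b \<longleftrightarrow>
     a \<in> verts G <+> edges G \<and> b \<in> verts G <+> edges G \<and> a \<noteq> b \<and>
     transformation_adj x y z G a b"
  by (auto simp: adjacent_def total_transformation_def Let_def doubleton_eq_iff
      transformation_adj_sym)

lemma finite_simple_graph_total_transformation:
  assumes "finite_simple_graph G"
  shows "finite_simple_graph (total_transformation x y z G)"
proof -
  have "finite (edges G)"
    using assms by (auto simp: finite_simple_graph_def intro: finite_subset[of _ "Pow (verts G)"])
  then have "finite (verts G <+> edges G)"
    using assms by (simp add: finite_simple_graph_def)
  moreover have "card {a, b} = 2" if "a \<noteq> b" for a b :: "'a + 'a set"
    using that by simp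
  ultimately show ?thesis
    unfolding finite_simple_graph_def total_transformation_def Let_def fst_conv snd_conv by blast
qed

end

theory Submission
  imports Defs
begin

text \<open>In \<open>G\<^sup>-\<^sup>+\<^sup>+\<close> a vertex \<open>u\<close> is joined to its \<open>n - 1 - d(u)\<close> non-neighbours and its
  \<open>d(u)\<close> incident edges, so its degree is \<open>n - 1\<close>. An edge \<open>uv\<close> is joined to its two
  endpoints and to \<open>(d(u) - 1) + (d(v) - 1)\<close> other edges, because \<open>uv\<close> is the only edge
  containing both \<open>u\<close> and \<open>v\<close>; so its degree is \<open>d(u) + d(v)\<close>.\<close>

lemma finite_edges:
  assumes "finite_simple_graph G"
  shows "finite (edges G)"
  using assms by (auto simp: finite_simple_graph_def intro: finite_subset[of _ "Pow (verts G)"])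

lemma adjacentD:
  assumes "finite_simple_graph G" and "adjacent G u v"
  shows "u \<in> verts G" and "v \<in> verts G" and "u \<noteq> v"
proof -
  have "{u, v} \<subseteq> verts G" and "card {u, v} = 2"
    using assms by (auto simp: finite_simple_graph_def adjacent_def)
  then show "u \<in> verts G" "v \<in> verts G" "u \<noteq> v"
    by auto
qed

text \<open>Sending a neighbour \<open>w\<close> to the edge \<open>{v, w}\<close> is a bijection
  onto the edges at \<open>v\<close>. Degrees in the transformation graph can thus be read off from
  its adjacency relation, without handling its set of two-element edges.\<close>

lemma vertex_degree_eq_card_neighbours:
  assumes "finite_simple_graph G"
  shows "vertex_degree G v = card {w. adjacent G v w}"
proof -
  have "{e \<in> edges G. v \<in> e} = (\<lambda>w. {v, w}) ` {w. adjacent G v w}"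
  proof (intro equalityI subsetI)
    fix e assume e: "e \<in> {e \<in> edges G. v \<in> e}"
    then have "card e = 2"
      using assms by (auto simp: finite_simple_graph_def)
    then obtain w where "e = {v, w}"
      using e by (auto simp: card_2_iff)
    then show "e \<in> (\<lambda>w. {v, w}) ` {w. adjacent G v w}"
      using e by (auto simp: adjacent_def)
  qed (auto simp: adjacent_def)
  moreover have "inj_on (\<lambda>w. {v, w}) {w. adjacent G v w}"
    by (auto simp: inj_on_def doubleton_eq_iff)
  ultimately show ?thesis
    by (simp add: vertex_degree_def card_image)
qed

lemma vertex_degree_transformation_Inl:
  assumes G: "finite_simple_graph G" and u: "u \<in> verts G"
  shows "vertex_degree (total_transformation Minus Plus Plus G) (Inl u) = card (verts G) - 1"
proof -
  let ?N = "{v. adjacent G u v}" and ?E = "{e \<in> edges G. u \<in> e}"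
  have fin: "finite (verts G)"
    using G by (simp add: finite_simple_graph_def)
  have N: "?N \<subseteq> verts G - {u}"
    using adjacentD(2,3)[OF G] by blast
  have finN: "finite ?N"
    using N fin by (meson finite_Diff finite_subset)
  \<comment> \<open>\<open>u\<close> is not in \<open>?N\<close>, so complementing adjacency alone
    would keep \<open>u\<close>; it is the distinctness condition that removes it.\<close>
  have "{b. adjacent (total_transformation Minus Plus Plus G) (Inl u) b} =
      (verts G - {u} - ?N) <+> ?E"
    using u by (auto simp: adjacent_total_transformation)
  then have "vertex_degree (total_transformation Minus Plus Plus G) (Inl u) =
      card (verts G - {u} - ?N) + card ?E"
    using fin finite_edges[OF G]
    by (simp add: vertex_degree_eq_card_neighbours finite_simple_graph_total_transformation G
        card_Plus)
  also have "card ?E = card ?N"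
    using vertex_degree_eq_card_neighbours[OF G, of u] by (simp add: vertex_degree_def)
  \<comment> \<open>\<open>card_mono\<close> ensures that the truncated subtraction from
    \<open>card_Diff_subset\<close> is exact.\<close>
  also have "card (verts G - {u} - ?N) + card ?N = card (verts G - {u})"
    using card_Diff_subset[OF finN N] card_mono[OF _ N] fin by simp
  finally show ?thesis
    using u by simp
qed

lemma vertex_degree_transformation_Inr:
  assumes G: "finite_simple_graph G" and e: "e \<in> edges G"
  shows "vertex_degree (total_transformation Minus Plus Plus G) (Inr e) =
    (\<Sum>v \<in> e. vertex_degree G v)"
proof -
  have "card e = 2" and sub: "e \<subseteq> verts G"
    using G e by (auto simp: finite_simple_graph_def)
  then obtain u v where uv: "e = {u, v}" "u \<noteq> v"
    by (auto simp: card_2_iff)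
  let ?U = "{f \<in> edges G. u \<in> f}" and ?V = "{f \<in> edges G. v \<in> f}"
  let ?F = "{f \<in> edges G. f \<noteq> e \<and> e \<inter> f \<noteq> {}}"
  have fin: "finite (edges G)"
    by (rule finite_edges[OF G])
  \<comment> \<open>The left summand is the edge \<open>e\<close> itself, read as the set of its two
    endpoints.\<close>
  have "{b. adjacent (total_transformation Minus Plus Plus G) (Inr e) b} = e <+> ?F"
    using e sub by (auto simp: adjacent_total_transformation)
  then have "vertex_degree (total_transformation Minus Plus Plus G) (Inr e) = 2 + card ?F"
    using fin uv
    by (simp add: vertex_degree_eq_card_neighbours finite_simple_graph_total_transformation G
        card_Plus)
  \<comment> \<open>The 2 counting the endpoints is split for inclusion-exclusion: one unit puts
    \<open>e\<close> back among the edges meeting it, giving \<open>?U \<union> ?V\<close>, and the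
    other is the size of \<open>?U \<inter> ?V\<close>.\<close>
  also have "\<dots> = card (insert e ?F) + card {e}"
    using fin by simp
  also have "insert e ?F = ?U \<union> ?V"
    using e uv by auto
  also have "{e} = ?U \<inter> ?V"
  proof -
    have "f = e" if "f \<in> edges G" "u \<in> f" "v \<in> f" for f
    proof -
      have "card f = 2"
        using G that by (auto simp: finite_simple_graph_def)
      then show ?thesis
        using that uv by (auto simp: card_2_iff)
    qed
    moreover have "u \<in> e" "v \<in> e"
      using uv by auto
    ultimately show ?thesis
      using e by blast
  qed
  also have "card (?U \<union> ?V) + card (?U \<inter> ?V) = card ?U + card ?V"
    using card_Un_Int[of ?U ?V] fin by simp
  finally show ?thesis
    using uv by (simp add: vertex_degree_def)
qed

theorem theorem10:
  fixes G :: "'a graph" and n m :: nat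
  assumes "finite_simple_graph G"
    and "card (verts G) = n"
    and "card (edges G) = m"
  shows "NK (total_transformation Minus Plus Plus G) = (n - 1) ^ n * mult_sum_Zagreb G"
proof -
  let ?d = "vertex_degree (total_transformation Minus Plus Plus G)"
  have "NK (total_transformation Minus Plus Plus G) = (\<Prod>a \<in> verts G <+> edges G. ?d a)"
    by (simp add: NK_def total_transformation_def Let_def)
  also have "\<dots> = (\<Prod>u \<in> verts G. ?d (Inl u)) * (\<Prod>e \<in> edges G. ?d (Inr e))"
    using assms(1) finite_edges[OF assms(1)]
    by (simp add: prod.Plus finite_simple_graph_def)
  \<comment> \<open>For \<open>n = 0\<close> the truncated \<open>n - 1\<close> is 0, but
    \<open>0 ^ 0 = 1\<close> agrees with the empty product over the vertices.\<close>
  also have "\<dots> = (n - 1) ^ n * mult_sum_Zagreb G"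
    using assms(2)
    by (simp add: vertex_degree_transformation_Inl vertex_degree_transformation_Inr assms(1)
        mult_sum_Zagreb_def)
  finally show ?thesis .
qed

end
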